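(* Suppose the weights $\rho(a,x)$ and $w(y)$ are known exactly, and let $\hat\theta_{\mathrm{IPW}}=\frac1n\sum_{i=1}^n \rho(a_i,x_i)\,y_i$ and $\hat\theta_{\mathrm{MR}}=\frac1n\sum_{i=1}^n w(y_i)\,y_i$. Then $\mathrm{Var}_{\pi^b}[\hat\theta_{\mathrm{MR}}]\le \mathrm{Var}_{\pi^b}[\hat\theta_{\mathrm{IPW}}]$. In particular, $$\mathrm{Var}_{\pi^b}[\hat\theta_{\mathrm{IPW}}]-\mathrm{Var}_{\pi^b}[\hat\theta_{\mathrm{MR}}]=\frac1n\,\mathbb{E}_{\pi^b}\!\left[\mathrm{Var}_{\pi^b}[\rho(A,X)\mid Y]\;Y^2\right]\ge 0 .$$
   Context: Contextual bandit setting. $X\in\mathcal X$ is a context, $A\in\mathcal A$ an action, $Y\in\mathcal Y\subseteq\mathbb R$ a scalar outcome; $p(x)$ is the density of contexts and $p(y\mid x,a)$ the conditional density of the outcome (densities with respect to fixed reference measures, e.g. Lebesgue or counting). For a policy $\pi(a\mid x)$ the joint density of $(X,A,Y)$ is $p_\pi(x,a,y)=p(y\mid x,a)\,\pi(a\mid x)\,p(x)$, with $Y$-marginal $p_\pi(y)=\int p_\pi(x,a,y)\,da\,dx$; $\mathbb E_\pi$, $\mathrm{Var}_\pi$ denote expectation and variance under $p_\pi$. There is a behaviour policy $\pi^b$ and a target policy $\pi^*$; the data $(x_i,a_i,y_i)_{i=1}^n$ are i.i.d. from $p_{\pi^b}(x,a,y)$, and the expectation and variance of estimators are over this data. Define $\rho(a,x)=\pi^*(a\mid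 x)/\pi^b(a\mid x)$ and $w(y)=p_{\pi^*}(y)/p_{\pi^b}(y)$. Standing assumption (support): for all $x\in\mathcal X,a\in\mathcal A$, $\pi^*(a\mid x)>0\implies\pi^b(a\mid x)>0$. All expectations and variances appearing are implicitly assumed to exist and be finite. *)

theory Defs
  imports "HOL-Probability.Probability"
begin

definition is_density :: "'s measure \<Rightarrow> ('s \<Rightarrow> real) \<Rightarrow> bool" where
  "is_density M f \<longleftrightarrow>
     f \<in> borel_measurable M \<and> (\<forall>s\<in>space M. 0 \<le> f s) \<and> (\<integral>\<^sup>+s. ennreal (f s) \<partial>M) = 1"

text \<open>\<open>f u v\<close> is the conditional density of \<open>v\<close> given \<open>u\<close>, with reference measure \<open>M\<close> for \<open>v\<close>.\<close>

definition is_cond_density :: "'u measure \<Rightarrow> 'v measure \<Rightarrow> ('u \<Rightarrow> 'v \<Rightarrow> real) \<Rightarrow> bool" where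
  "is_cond_density N M f \<longleftrightarrow>
     (\<lambda>(u, v). f u v) \<in> borel_measurable (N \<Otimes>\<^sub>M M) \<and> (\<forall>u\<in>space N. is_density M (f u))"

text \<open>A policy \<open>\<pi> a x\<close> stands for \<open>\<pi>(a | x)\<close>.\<close>

definition is_policy :: "'x measure \<Rightarrow> 'a measure \<Rightarrow> ('a \<Rightarrow> 'x \<Rightarrow> real) \<Rightarrow> bool" where
  "is_policy MX MA \<pi> \<longleftrightarrow> is_cond_density MX MA (\<lambda>x a. \<pi> a x)"

text \<open>Throughout, \<open>MX\<close>, \<open>MA\<close>, \<open>MY\<close> are the reference measures on contexts, actions and outcomes,
  \<open>p x\<close> is the context density and \<open>q x a y\<close> stands for \<open>p(y | x, a)\<close>.\<close>

definition joint_density ::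
  "('x \<Rightarrow> real) \<Rightarrow> ('x \<Rightarrow> 'a \<Rightarrow> real \<Rightarrow> real) \<Rightarrow> ('a \<Rightarrow> 'x \<Rightarrow> real) \<Rightarrow> 'x \<times> 'a \<times> real \<Rightarrow> real" where
  "joint_density p q \<pi> = (\<lambda>(x, a, y). q x a y * \<pi> a x * p x)"

definition joint_law ::
  "'x measure \<Rightarrow> 'a measure \<Rightarrow> real measure \<Rightarrow> ('x \<Rightarrow> real) \<Rightarrow> ('x \<Rightarrow> 'a \<Rightarrow> real \<Rightarrow> real) \<Rightarrow>
   ('a \<Rightarrow> 'x \<Rightarrow> real) \<Rightarrow> ('x \<times> 'a \<times> real) measure" where
  "joint_law MX MA MY p q \<pi> =
     density (MX \<Otimes>\<^sub>M MA \<Otimes>\<^sub>M MY) (\<lambda>z. ennreal (joint_density p q \<pi> z))"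

definition outcome_density ::
  "'x measure \<Rightarrow> 'a measure \<Rightarrow> ('x \<Rightarrow> real) \<Rightarrow> ('x \<Rightarrow> 'a \<Rightarrow> real \<Rightarrow> real) \<Rightarrow>
   ('a \<Rightarrow> 'x \<Rightarrow> real) \<Rightarrow> real \<Rightarrow> real" where
  "outcome_density MX MA p q \<pi> y = (\<integral>x. (\<integral>a. joint_density p q \<pi> (x, a, y) \<partial>MA) \<partial>MX)"

text \<open>Both ratios take the value 0 where the denominator vanishes, which is a null event
  under the law of the behaviour policy \<open>\<pi>b\<close>.\<close>

definition policy_ratio ::
  "('a \<Rightarrow> 'x \<Rightarrow> real) \<Rightarrow> ('a \<Rightarrow> 'x \<Rightarrow> real) \<Rightarrow> 'a \<Rightarrow> 'x \<Rightarrow> real" where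
  "policy_ratio \<pi>t \<pi>b a x = \<pi>t a x / \<pi>b a x"

definition outcome_ratio ::
  "'x measure \<Rightarrow> 'a measure \<Rightarrow> ('x \<Rightarrow> real) \<Rightarrow> ('x \<Rightarrow> 'a \<Rightarrow> real \<Rightarrow> real) \<Rightarrow>
   ('a \<Rightarrow> 'x \<Rightarrow> real) \<Rightarrow> ('a \<Rightarrow> 'x \<Rightarrow> real) \<Rightarrow> real \<Rightarrow> real" where
  "outcome_ratio MX MA p q \<pi>t \<pi>b y =
     outcome_density MX MA p q \<pi>t y / outcome_density MX MA p q \<pi>b y"

definition IPW_estimator ::
  "('a \<Rightarrow> 'x \<Rightarrow> real) \<Rightarrow> nat \<Rightarrow> (nat \<Rightarrow> 'x \<times> 'a \<times> real) \<Rightarrow> real" where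
  "IPW_estimator \<rho> n d = 1 / real n * (\<Sum>i<n. case d i of (x, a, y) \<Rightarrow> \<rho> a x * y)"

definition MR_estimator ::
  "(real \<Rightarrow> real) \<Rightarrow> nat \<Rightarrow> (nat \<Rightarrow> 'x \<times> 'a \<times> real) \<Rightarrow> real" where
  "MR_estimator w n d = 1 / real n * (\<Sum>i<n. case d i of (x, a, y) \<Rightarrow> w y * y)"

text \<open>\<open>Var[f | Y] = E[(f - E[f | Y])^2 | Y]\<close>, conditioning on the sigma-algebra generated by \<open>Y\<close>.
  By the definition of \<^const>\<open>real_cond_exp\<close> it is set to 0 where the outer conditional
  expectation is infinite.\<close>

definition cond_variance :: "'s measure \<Rightarrow> ('s \<Rightarrow> real) \<Rightarrow> ('s \<Rightarrow> real) \<Rightarrow> 's \<Rightarrow> real" where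
  "cond_variance M f Y =
     (let F = vimage_algebra (space M) Y borel
      in real_cond_exp M F (\<lambda>s. (f s - real_cond_exp M F f s)\<^sup>2))"

end

theory Submission
  imports Defs
begin

text \<open>The weight \<open>w(Y)\<close> is the conditional expectation \<open>E[\<rho>(A,X) | Y]\<close> under the behaviour
  policy. Hence \<open>w(Y) Y\<close> is the \<open>L\<^sup>2\<close> projection of \<open>\<rho>(A,X) Y\<close> onto the \<open>Y\<close>-measurable
  functions: both have the same mean, and their second moments differ by
  \<open>E[(\<rho> - w(Y))\<^sup>2 Y\<^sup>2] = E[Var[\<rho> | Y] Y\<^sup>2]\<close>. Averaging \<open>n\<close> independent copies divides both
  variances by \<open>n\<close>.\<close>

section \<open>Variance of the mean of an i.i.d. sample\<close>

text \<open>After centring, the variance is \<open>1 / n^2\<close> times a double sum of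
  covariances. Independence removes the off-diagonal terms, and the \<open>n\<close> equal diagonal
  terms cancel one factor \<open>n\<close>.\<close>

lemma (in prob_space) variance_iid_mean:
  fixes f :: "'b \<Rightarrow> real" and D :: "nat \<Rightarrow> 'a \<Rightarrow> 'b"
  assumes n: "n \<ge> 1"
    and indep: "indep_vars (\<lambda>_. N) D {..<n}"
    and ident: "\<And>i. i < n \<Longrightarrow> distr M N (D i) = P"
    and f[measurable]: "f \<in> borel_measurable N"
    and sq: "integrable P (\<lambda>z. (f z)\<^sup>2)"
  shows "variance (\<lambda>\<omega>. 1 / real n * (\<Sum>i<n. f (D i \<omega>))) = 1 / real n * (\<integral>z. (f z - (\<integral>z. f z \<partial>P))\<^sup>2 \<partial>P)"
proof -
  define \<mu> where "\<mu> = (\<integral>z. f z \<partial>P)"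
  define Z where "Z i \<omega> = f (D i \<omega>) - \<mu>" for i \<omega>
  have D[measurable]: "D i \<in> measurable M N" if "i < n" for i
    using indep that by (auto simp: indep_vars_def)
  \<comment> \<open>\<open>P\<close> is known only as the law of the observations;
    \<open>n \<ge> 1\<close> provides index 0, which shows that \<open>P\<close> is a probability
    measure.\<close>
  have P: "P = distr M N (D 0)" using ident[of 0] n by simp
  interpret P: prob_space P
    unfolding P using n by (intro prob_space_distr D) simp
  have [measurable]: "f \<in> borel_measurable P"
    unfolding P by simp
  have f_int: "integrable P f"
    by (rule P.square_integrable_imp_integrable[OF _ sq]) simp
  have sq_int: "integrable P (\<lambda>z. (f z - \<mu>)\<^sup>2)"
    unfolding power2_diff using sq f_int by (auto simp: mult.commute)
  have transfer: "integrable M (\<lambda>\<omega>. g (D i \<omega>)) \<and> expectation (\<lambda>\<omega>. g (D i \<omega>)) = (\<integral>z. g z \<partial>P)"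
    if "i < n" "integrable P g" for i and g :: "'b \<Rightarrow> real"
  proof -
    have g: "g \<in> borel_measurable N"
      using borel_measurable_integrable[OF that(2)] unfolding P by simp
    show ?thesis
      using that(2) g unfolding ident[OF that(1), symmetric]
      by (simp add: integral_distr[OF D[OF that(1)]] integrable_distr_eq[OF D[OF that(1)]])
  qed
  have Z_int: "integrable M (Z i)" "expectation (Z i) = 0" if "i < n" for i
    using transfer[OF that, of "\<lambda>z. f z - \<mu>"] f_int
    by (auto simp: Z_def[abs_def] \<mu>_def P.prob_space)
  have Z_sq: "integrable M (\<lambda>\<omega>. Z i \<omega> * Z i \<omega>)"
    "expectation (\<lambda>\<omega>. Z i \<omega> * Z i \<omega>) = (\<integral>z. (f z - \<mu>)\<^sup>2 \<partial>P)" if "i < n" for i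
    using transfer[OF that sq_int] by (auto simp: Z_def power2_eq_square)
  have indep_Z: "indep_vars (\<lambda>_. borel) Z {..<n}"
    unfolding Z_def[abs_def] by (rule indep_vars_compose2[OF indep]) simp
  \<comment> \<open>Restricting the independent family to \<open>{i, j}\<close> gives both
    integrability of the product and factorisation of its mean; each factor has mean zero.\<close>
  have cross: "integrable M (\<lambda>\<omega>. Z i \<omega> * Z j \<omega>)" "expectation (\<lambda>\<omega>. Z i \<omega> * Z j \<omega>) = 0"
    if "i < n" "j < n" "i \<noteq> j" for i j
  proof -
    have ind: "indep_vars (\<lambda>_. borel) Z {i, j}"
      using that by (intro indep_vars_subset[OF indep_Z]) auto
    show "integrable M (\<lambda>\<omega>. Z i \<omega> * Z j \<omega>)"
      using indep_vars_integrable[OF _ ind] that Z_int by auto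
    show "expectation (\<lambda>\<omega>. Z i \<omega> * Z j \<omega>) = 0"
      using indep_vars_lebesgue_integral[OF _ ind] that Z_int by auto
  qed
  have pair_int: "integrable M (\<lambda>\<omega>. Z i \<omega> * Z j \<omega>)" if "i < n" "j < n" for i j
    using Z_sq cross that by (cases "i = j") auto
  have pair_exp: "expectation (\<lambda>\<omega>. Z i \<omega> * Z j \<omega>) = (if i = j then \<integral>z. (f z - \<mu>)\<^sup>2 \<partial>P else 0)"
    if "i < n" "j < n" for i j
    using Z_sq cross that by (cases "i = j") auto
  have mean: "expectation (\<lambda>\<omega>. 1 / real n * (\<Sum>i<n. f (D i \<omega>))) = \<mu>"
    using n transfer[OF _ f_int] by (simp add: \<mu>_def)
  \<comment> \<open>Since \<open>n \<noteq> 0\<close>, the constant \<open>\<mu>\<close> is the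
    average of \<open>n\<close> copies of itself and can be absorbed into the summands. Squaring
    then gives a double sum to which \<open>pair_exp\<close> applies.\<close>
  have centred: "(1 / real n * (\<Sum>i<n. f (D i \<omega>)) - \<mu>)\<^sup>2
      = 1 / (real n)\<^sup>2 * (\<Sum>i<n. \<Sum>j<n. Z i \<omega> * Z j \<omega>)" for \<omega>
  proof -
    have "1 / real n * (\<Sum>i<n. f (D i \<omega>)) - \<mu> = 1 / real n * (\<Sum>i<n. Z i \<omega>)"
      using n by (simp add: Z_def sum_subtractf field_simps)
    then show ?thesis
      by (simp add: power_divide power2_eq_square sum_product)
  qed
  have sum_exp: "expectation (\<lambda>\<omega>. c * (\<Sum>i<n. \<Sum>j<n. Z i \<omega> * Z j \<omega>))
      = c * (\<Sum>i<n. \<Sum>j<n. expectation (\<lambda>\<omega>. Z i \<omega> * Z j \<omega>))" for c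
    using pair_int by (subst integral_mult_right_zero, subst Bochner_Integration.integral_sum)
      (auto intro!: sum.cong Bochner_Integration.integrable_sum Bochner_Integration.integral_sum)
  have "variance (\<lambda>\<omega>. 1 / real n * (\<Sum>i<n. f (D i \<omega>)))
      = 1 / (real n)\<^sup>2 * (\<Sum>i<n. \<Sum>j<n. expectation (\<lambda>\<omega>. Z i \<omega> * Z j \<omega>))"
    unfolding mean centred sum_exp by simp
  also have "(\<Sum>i<n. \<Sum>j<n. expectation (\<lambda>\<omega>. Z i \<omega> * Z j \<omega>)) = real n * (\<integral>z. (f z - \<mu>)\<^sup>2 \<partial>P)"
    by (simp add: pair_exp)
  finally show ?thesis
    using n by (simp add: \<mu>_def power2_eq_square)
qed

section \<open>Conditional expectation and variance given a real random variable\<close>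

text \<open>Pointwise, \<open>\<bar>f g\<bar> \<le> f^2 + g^2\<close>. Needed for the cross term of
  \<open>C * Y\<close> and \<open>X * Y\<close> when the squared residual is expanded.\<close>

lemma integrable_mult_of_squares:
  fixes f g :: "'a \<Rightarrow> real"
  assumes [measurable]: "f \<in> borel_measurable M" "g \<in> borel_measurable M"
    and "integrable M (\<lambda>x. (f x)\<^sup>2)" "integrable M (\<lambda>x. (g x)\<^sup>2)"
  shows "integrable M (\<lambda>x. f x * g x)"
proof (rule Bochner_Integration.integrable_bound)
  show "integrable M (\<lambda>x. (f x)\<^sup>2 + (g x)\<^sup>2)" using assms by simp
  show "AE x in M. norm (f x * g x) \<le> norm ((f x)\<^sup>2 + (g x)\<^sup>2)"
  proof (rule AE_I2)
    fix x
    show "norm (f x * g x) \<le> norm ((f x)\<^sup>2 + (g x)\<^sup>2)"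
      using sum_squares_bound[of "\<bar>f x\<bar>" "\<bar>g x\<bar>"] abs_ge_zero[of "f x * g x"]
      unfolding real_norm_def power2_abs abs_mult by linarith
  qed
qed simp

text \<open>\<open>X\<close> itself need not be square integrable, only \<open>X * Y\<close>; so \<^const>\<open>cond_variance\<close> is meaningful
  only off \<open>{Y = 0}\<close>, which the factor \<open>Y\<^sup>2\<close> takes care of.\<close>

lemma (in prob_space) cond_exp_generated:
  fixes X Y :: "'a \<Rightarrow> real"
  defines "F \<equiv> vimage_algebra (space M) Y borel"
  defines "C \<equiv> real_cond_exp M F X"
  assumes X: "integrable M X" and Y[measurable]: "Y \<in> borel_measurable M"
    and sq: "integrable M (\<lambda>s. (X s * Y s)\<^sup>2)"
  shows cond_exp_square_integrable: "integrable M (\<lambda>s. (C s * Y s)\<^sup>2)"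
    and expectation_cond_exp_mult: "expectation (\<lambda>s. C s * Y s) = expectation (\<lambda>s. X s * Y s)"
    and expectation_cond_variance:
      "expectation (\<lambda>s. cond_variance M X Y s * (Y s)\<^sup>2)
        = expectation (\<lambda>s. (X s * Y s)\<^sup>2) - expectation (\<lambda>s. (C s * Y s)\<^sup>2)"
    and expectation_cond_variance_nonneg: "0 \<le> expectation (\<lambda>s. cond_variance M X Y s * (Y s)\<^sup>2)"
proof -
  have sub: "subalgebra M F"
    unfolding F_def subalgebra_def using measurable_sets[OF Y]
    by (auto simp: sets_vimage_algebra2)
  interpret F: finite_measure_subalgebra M F
    by unfold_locales (rule sub)
  have [measurable]: "X \<in> borel_measurable M" "C \<in> borel_measurable F" "C \<in> borel_measurable M"
    using X by (auto simp: C_def)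
  have YF[measurable]: "Y \<in> borel_measurable F"
    unfolding F_def by (rule measurable_vimage_algebra1) simp
  have XY: "integrable M (\<lambda>s. Y s * X s)"
    using square_integrable_imp_integrable[of "\<lambda>s. Y s * X s"] sq by (simp add: mult.commute)
  have pull_out: "AE s in M. real_cond_exp M F (\<lambda>s. Y s * X s) s = C s * Y s"
    using F.real_cond_exp_mult[OF YF _ XY] by (simp add: C_def mult.commute)
  \<comment> \<open>Conditional Jensen for the square: the conditional expectation of
    \<open>X * Y\<close> inherits a finite second moment, and \<open>pull_out\<close> identifies it
    with \<open>C * Y\<close>.\<close>
  have "integrable M (\<lambda>s. (real_cond_exp M F (\<lambda>s. Y s * X s) s)\<^sup>2)"
    using F.integrable_convex_cond_exp[where I=UNIV and q="\<lambda>t. t\<^sup>2", OF XY] sq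
    by (auto simp: mult.commute convex_power2)
  also have "?this \<longleftrightarrow> integrable M (\<lambda>s. (C s * Y s)\<^sup>2)"
    using pull_out by (intro integrable_cong_AE) auto
  finally show CY: "integrable M (\<lambda>s. (C s * Y s)\<^sup>2)" .
  show "expectation (\<lambda>s. C s * Y s) = expectation (\<lambda>s. X s * Y s)"
    using F.real_cond_exp_intg(2)[of Y X] XY by (simp add: C_def mult.commute)
  have prod: "integrable M (\<lambda>s. (C s * Y s) * (X s * Y s))"
    using CY sq by (intro integrable_mult_of_squares) auto
  \<comment> \<open>Orthogonality of the projection: grouped as \<open>C * Y^2\<close>, the
    multiplier is measurable for \<open>F\<close>, so \<open>X\<close> may be replaced by
    \<open>C\<close> under the expectation.\<close>
  have "expectation (\<lambda>s. (C s * Y s) * (X s * Y s)) = expectation (\<lambda>s. (C s * (Y s)\<^sup>2) * X s)"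
    by (simp add: power2_eq_square mult_ac)
  also have "\<dots> = expectation (\<lambda>s. (C s * (Y s)\<^sup>2) * C s)"
    unfolding C_def using prod
    by (intro F.real_cond_exp_intg(2)[symmetric]) (auto simp: C_def power2_eq_square mult_ac)
  finally have orth: "expectation (\<lambda>s. (C s * Y s) * (X s * Y s)) = expectation (\<lambda>s. (C s * Y s)\<^sup>2)"
    by (simp add: power2_eq_square mult_ac)
  have split: "(Y s)\<^sup>2 * (X s - C s)\<^sup>2 = (X s * Y s)\<^sup>2 - 2 * ((C s * Y s) * (X s * Y s)) + (C s * Y s)\<^sup>2" for s
    by (simp add: power2_eq_square algebra_simps)
  have cv: "expectation (\<lambda>s. cond_variance M X Y s * (Y s)\<^sup>2)
      = expectation (\<lambda>s. (Y s)\<^sup>2 * real_cond_exp M F (\<lambda>s. (X s - C s)\<^sup>2) s)"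
    by (simp add: cond_variance_def Let_def F_def C_def mult.commute)
  \<comment> \<open>The weight \<open>Y^2\<close> is nonnegative and measurable for
    \<open>F\<close>, so the outer conditional expectation disappears on integration. This rests on
    integrability of the weighted residual, which \<open>split\<close> reduces to three integrable
    terms.\<close>
  also have residual: "\<dots> = expectation (\<lambda>s. (Y s)\<^sup>2 * (X s - C s)\<^sup>2)"
    using sq CY prod by (intro F.real_cond_exp_intg_fpos(2)) (auto simp: split)
  also have "\<dots> = expectation (\<lambda>s. (X s * Y s)\<^sup>2) - expectation (\<lambda>s. (C s * Y s)\<^sup>2)"
    unfolding split using sq CY prod orth by simp
  finally show "expectation (\<lambda>s. cond_variance M X Y s * (Y s)\<^sup>2)
      = expectation (\<lambda>s. (X s * Y s)\<^sup>2) - expectation (\<lambda>s. (C s * Y s)\<^sup>2)" .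
  show "0 \<le> expectation (\<lambda>s. cond_variance M X Y s * (Y s)\<^sup>2)"
    unfolding cv residual by (intro Bochner_Integration.integral_nonneg) simp
qed

section \<open>The bandit model: joint law and outcome marginal\<close>

text \<open>\<open>sets_MY\<close> puts the trace of the Borel sigma-algebra on the outcomes. It is
  used in two directions: the inclusion of outcomes into the reals is measurable, and a Borel map
  with values in \<open>space MY\<close> is measurable into \<open>MY\<close>.\<close>

locale bandit_model =
  fixes MX :: "'x measure" and MA :: "'a measure" and MY :: "real measure"
    and p :: "'x \<Rightarrow> real" and q :: "'x \<Rightarrow> 'a \<Rightarrow> real \<Rightarrow> real"
  assumes sigma_finite_MX: "sigma_finite_measure MX"
    and sigma_finite_MA: "sigma_finite_measure MA"
    and sigma_finite_MY: "sigma_finite_measure MY"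
    and sets_MY: "sets MY = sets (restrict_space borel (space MY))"
    and context_density: "is_density MX p"
    and outcome_cond_density: "is_cond_density (MX \<Otimes>\<^sub>M MA) MY (\<lambda>(x, a). q x a)"
begin

sublocale X: sigma_finite_measure MX by (rule sigma_finite_MX)
sublocale A: sigma_finite_measure MA by (rule sigma_finite_MA)
sublocale Y: sigma_finite_measure MY by (rule sigma_finite_MY)
sublocale XY: pair_sigma_finite MX MY ..
sublocale AY: pair_sigma_finite MA MY ..

abbreviation "law \<equiv> joint_law MX MA MY p q"
abbreviation "dens \<equiv> outcome_density MX MA p q"
abbreviation "jd \<equiv> joint_density p q"

lemma measurable_context_density[measurable]: "p \<in> borel_measurable MX"
  using context_density by (simp add: is_density_def)

lemma measurable_outcome_cond_density[measurable]:
  "(\<lambda>(x, a, y). q x a y) \<in> borel_measurable (MX \<Otimes>\<^sub>M MA \<Otimes>\<^sub>M MY)"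
proof -
  have *: "(\<lambda>(u, y). (\<lambda>(x, a). q x a) u y) \<in> borel_measurable ((MX \<Otimes>\<^sub>M MA) \<Otimes>\<^sub>M MY)"
    using outcome_cond_density by (simp add: is_cond_density_def)
  have "(\<lambda>(x, a, y). ((x, a), y)) \<in> measurable (MX \<Otimes>\<^sub>M MA \<Otimes>\<^sub>M MY) ((MX \<Otimes>\<^sub>M MA) \<Otimes>\<^sub>M MY)"
    by measurable
  from measurable_compose[OF this *] show ?thesis
    by (simp add: case_prod_beta')
qed

lemma measurable_policy:
  assumes "is_policy MX MA \<pi>"
  shows "(\<lambda>(x, a). \<pi> a x) \<in> borel_measurable (MX \<Otimes>\<^sub>M MA)"
  using assms by (simp add: is_policy_def is_cond_density_def)

lemma measurable_joint_density:
  assumes "is_policy MX MA \<pi>"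
  shows "jd \<pi> \<in> borel_measurable (MX \<Otimes>\<^sub>M MA \<Otimes>\<^sub>M MY)"
proof -
  note [measurable] = measurable_policy[OF assms]
  have "(\<lambda>z. (case z of (x, a, y) \<Rightarrow> q x a y) * (case (fst z, fst (snd z)) of (x, a) \<Rightarrow> \<pi> a x) * p (fst z))
      \<in> borel_measurable (MX \<Otimes>\<^sub>M MA \<Otimes>\<^sub>M MY)"
    by measurable
  then show ?thesis
    by (simp add: joint_density_def case_prod_beta')
qed

lemma context_density_nonneg: "x \<in> space MX \<Longrightarrow> 0 \<le> p x"
  using context_density by (simp add: is_density_def)

lemma outcome_cond_density_is_density:
  "x \<in> space MX \<Longrightarrow> a \<in> space MA \<Longrightarrow> is_density MY (q x a)"
  using outcome_cond_density unfolding is_cond_density_def by (auto simp: space_pair_measure)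

lemma policy_is_density:
  "is_policy MX MA \<pi> \<Longrightarrow> x \<in> space MX \<Longrightarrow> is_density MA (\<lambda>a. \<pi> a x)"
  unfolding is_policy_def is_cond_density_def by blast

lemma policy_nonneg:
  "is_policy MX MA \<pi> \<Longrightarrow> x \<in> space MX \<Longrightarrow> a \<in> space MA \<Longrightarrow> 0 \<le> \<pi> a x"
  using policy_is_density[of \<pi> x] unfolding is_density_def by blast

lemma outcome_cond_density_nonneg:
  "x \<in> space MX \<Longrightarrow> a \<in> space MA \<Longrightarrow> y \<in> space MY \<Longrightarrow> 0 \<le> q x a y"
  using outcome_cond_density_is_density[of x a] unfolding is_density_def by blast

lemmas nonneg = context_density_nonneg policy_nonneg outcome_cond_density_nonneg

lemma joint_density_nonneg:
  "is_policy MX MA \<pi> \<Longrightarrow> x \<in> space MX \<Longrightarrow> a \<in> space MA \<Longrightarrow> y \<in> space MY \<Longrightarrow> 0 \<le> jd \<pi> (x, a, y)"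
  by (simp add: joint_density_def nonneg)

lemma nn_integral_law:
  assumes \<pi>: "is_policy MX MA \<pi>"
    and h[measurable]: "h \<in> borel_measurable (MX \<Otimes>\<^sub>M MA \<Otimes>\<^sub>M MY)"
  shows "(\<integral>\<^sup>+z. h z \<partial>law \<pi>)
    = (\<integral>\<^sup>+x. \<integral>\<^sup>+a. \<integral>\<^sup>+y. ennreal (jd \<pi> (x, a, y)) * h (x, a, y) \<partial>MY \<partial>MA \<partial>MX)"
proof -
  note [measurable] = measurable_joint_density[OF \<pi>]
  have "(\<integral>\<^sup>+z. h z \<partial>law \<pi>) = (\<integral>\<^sup>+z. ennreal (jd \<pi> z) * h z \<partial>(MX \<Otimes>\<^sub>M MA \<Otimes>\<^sub>M MY))"
    by (simp add: joint_law_def nn_integral_density)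
  also have "\<dots> = (\<integral>\<^sup>+x. \<integral>\<^sup>+u. ennreal (jd \<pi> (x, u)) * h (x, u) \<partial>(MA \<Otimes>\<^sub>M MY) \<partial>MX)"
    by (intro AY.nn_integral_fst[symmetric]) simp
  also have "\<dots> = (\<integral>\<^sup>+x. \<integral>\<^sup>+a. \<integral>\<^sup>+y. ennreal (jd \<pi> (x, a, y)) * h (x, a, y) \<partial>MY \<partial>MA \<partial>MX)"
    by (intro nn_integral_cong Y.nn_integral_fst[symmetric]) simp
  finally show ?thesis .
qed

text \<open>Integrating from the inside out, the densities in \<open>y\<close>, in \<open>a\<close>
  and in \<open>x\<close> successively contribute total mass one.\<close>

lemma prob_space_law:
  assumes \<pi>: "is_policy MX MA \<pi>"
  shows "prob_space (law \<pi>)"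
proof
  have q1: "(\<integral>\<^sup>+y. ennreal (q x a y) \<partial>MY) = 1" if "x \<in> space MX" "a \<in> space MA" for x a
    using outcome_cond_density_is_density[OF that] unfolding is_density_def by blast
  have \<pi>1: "(\<integral>\<^sup>+a. ennreal (\<pi> a x) \<partial>MA) = 1" if "x \<in> space MX" for x
    using policy_is_density[OF \<pi> that] unfolding is_density_def by blast
  note [measurable] = measurable_policy[OF \<pi>] measurable_joint_density[OF \<pi>]
  have "emeasure (law \<pi>) (space (law \<pi>)) = (\<integral>\<^sup>+z. 1 \<partial>law \<pi>)"
    by simp
  also have "\<dots> = (\<integral>\<^sup>+x. \<integral>\<^sup>+a. \<integral>\<^sup>+y. ennreal (jd \<pi> (x, a, y)) \<partial>MY \<partial>MA \<partial>MX)"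
    by (subst nn_integral_law[OF \<pi>]) auto
  also have "\<dots> = (\<integral>\<^sup>+x. \<integral>\<^sup>+a. ennreal (\<pi> a x) * ennreal (p x) \<partial>MA \<partial>MX)"
  proof (intro nn_integral_cong)
    fix x a assume xa: "x \<in> space MX" "a \<in> space MA"
    have "(\<integral>\<^sup>+y. ennreal (jd \<pi> (x, a, y)) \<partial>MY)
        = (\<integral>\<^sup>+y. ennreal (q x a y) * (ennreal (\<pi> a x) * ennreal (p x)) \<partial>MY)"
      using xa \<pi> by (intro nn_integral_cong) (simp add: joint_density_def nonneg ennreal_mult'' mult.assoc)
    also have "\<dots> = ennreal (\<pi> a x) * ennreal (p x)"
      using xa q1[OF xa] measurable_outcome_cond_density by (subst nn_integral_multc) auto
    finally show "(\<integral>\<^sup>+y. ennreal (jd \<pi> (x, a, y)) \<partial>MY) = ennreal (\<pi> a x) * ennreal (p x)" .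
  qed
  also have "\<dots> = (\<integral>\<^sup>+x. ennreal (p x) \<partial>MX)"
    using \<pi>1 by (intro nn_integral_cong) (subst nn_integral_multc, auto)
  also have "\<dots> = 1"
    using context_density by (simp add: is_density_def)
  finally show "emeasure (law \<pi>) (space (law \<pi>)) = 1" .
qed

text \<open>Tonelli moves the outcome integral outermost. The inner factor stays a nonnegative
  integral, because its agreement with the Bochner integral \<open>dens \<pi>\<close> is established
  only almost everywhere, in \<open>AE_ennreal_outcome_density\<close>.\<close>

lemma nn_integral_law_outcome:
  assumes \<pi>: "is_policy MX MA \<pi>" and [measurable]: "h \<in> borel_measurable MY"
  shows "(\<integral>\<^sup>+(x, a, y). h y \<partial>law \<pi>)
    = (\<integral>\<^sup>+y. (\<integral>\<^sup>+x. \<integral>\<^sup>+a. ennreal (jd \<pi> (x, a, y)) \<partial>MA \<partial>MX) * h y \<partial>MY)"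
proof -
  note [measurable] = measurable_joint_density[OF \<pi>]
  have "(\<integral>\<^sup>+(x, a, y). h y \<partial>law \<pi>)
      = (\<integral>\<^sup>+x. \<integral>\<^sup>+a. \<integral>\<^sup>+y. ennreal (jd \<pi> (x, a, y)) * h y \<partial>MY \<partial>MA \<partial>MX)"
    by (subst nn_integral_law[OF \<pi>]) auto
  also have "\<dots> = (\<integral>\<^sup>+x. \<integral>\<^sup>+y. \<integral>\<^sup>+a. ennreal (jd \<pi> (x, a, y)) * h y \<partial>MA \<partial>MY \<partial>MX)"
    by (intro nn_integral_cong AY.Fubini'[symmetric]) measurable
  also have "\<dots> = (\<integral>\<^sup>+y. \<integral>\<^sup>+x. \<integral>\<^sup>+a. ennreal (jd \<pi> (x, a, y)) * h y \<partial>MA \<partial>MX \<partial>MY)"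
    by (intro XY.Fubini'[symmetric]) measurable
  also have "\<dots> = (\<integral>\<^sup>+y. (\<integral>\<^sup>+x. \<integral>\<^sup>+a. ennreal (jd \<pi> (x, a, y)) \<partial>MA \<partial>MX) * h y \<partial>MY)"
    by (simp add: nn_integral_multc cong: nn_integral_cong)
  finally show ?thesis .
qed

lemma outcome_measurable[measurable]: "(\<lambda>y. y) \<in> borel_measurable MY"
  by (simp add: measurable_cong_sets[OF sets_MY] measurable_restrict_space1)

lemma measurable_outcome_density:
  assumes "is_policy MX MA \<pi>"
  shows "dens \<pi> \<in> borel_measurable MY"
proof -
  note [measurable] = measurable_joint_density[OF assms]
  show ?thesis unfolding outcome_density_def[abs_def] by measurable
qed

lemma outcome_density_nonneg:
  assumes "is_policy MX MA \<pi>" "y \<in> space MY"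
  shows "0 \<le> dens \<pi> y"
  unfolding outcome_density_def using assms
  by (intro integral_nonneg_AE AE_I2) (auto simp: joint_density_nonneg)

text \<open>A divergent Bochner integral has the default value 0, so exceptional outcomes must be
  discarded. The marginal has total mass 1, hence is finite for almost every \<open>y\<close>; for
  such \<open>y\<close> the inner integral is finite for almost every \<open>x\<close>, and there
  both notions of integral coincide.\<close>

lemma AE_ennreal_outcome_density:
  assumes \<pi>: "is_policy MX MA \<pi>"
  shows "AE y in MY. ennreal (dens \<pi> y) = (\<integral>\<^sup>+x. \<integral>\<^sup>+a. ennreal (jd \<pi> (x, a, y)) \<partial>MA \<partial>MX)"
proof -
  interpret P: prob_space "law \<pi>" by (rule prob_space_law[OF \<pi>])
  note [measurable] = measurable_joint_density[OF \<pi>]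
  let ?g = "\<lambda>x y. \<integral>\<^sup>+a. ennreal (jd \<pi> (x, a, y)) \<partial>MA"
  have "(\<integral>\<^sup>+y. (\<integral>\<^sup>+x. ?g x y \<partial>MX) \<partial>MY) = (\<integral>\<^sup>+(x, a, y). 1 \<partial>law \<pi>)"
    by (subst nn_integral_law_outcome[OF \<pi>]) auto
  also have "\<dots> = 1"
    using P.emeasure_space_1 by (simp add: case_prod_beta')
  finally have "AE y in MY. (\<integral>\<^sup>+x. ?g x y \<partial>MX) \<noteq> \<infinity>"
    by (intro nn_integral_PInf_AE) auto
  then show ?thesis
  proof (rule AE_mp, intro AE_I2 impI)
    fix y assume y[measurable]: "y \<in> space MY" and fin: "(\<integral>\<^sup>+x. ?g x y \<partial>MX) \<noteq> \<infinity>"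
    have "AE x in MX. ?g x y \<noteq> \<infinity>"
      using fin by (intro nn_integral_PInf_AE) auto
    then have "AE x in MX. ennreal (\<integral>a. jd \<pi> (x, a, y) \<partial>MA) = ?g x y"
    proof (rule AE_mp, intro AE_I2 impI)
      fix x assume x[measurable]: "x \<in> space MX" and "?g x y \<noteq> \<infinity>"
      then show "ennreal (\<integral>a. jd \<pi> (x, a, y) \<partial>MA) = ?g x y"
        using y \<pi> by (subst integral_eq_nn_integral)
          (auto simp: joint_density_nonneg ennreal_enn2real_if intro!: AE_I2)
    qed
    then have "(\<integral>\<^sup>+x. ennreal (\<integral>a. jd \<pi> (x, a, y) \<partial>MA) \<partial>MX) = (\<integral>\<^sup>+x. ?g x y \<partial>MX)"
      by (rule nn_integral_cong_AE)
    then show "ennreal (dens \<pi> y) = (\<integral>\<^sup>+x. ?g x y \<partial>MX)"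
      using fin y \<pi> unfolding outcome_density_def
      by (subst integral_eq_nn_integral)
        (auto simp: ennreal_enn2real_if joint_density_nonneg intro!: AE_I2 integral_nonneg_AE)
  qed
qed

lemma nn_integral_law_outcome_density:
  assumes \<pi>: "is_policy MX MA \<pi>" and "h \<in> borel_measurable MY"
  shows "(\<integral>\<^sup>+(x, a, y). h y \<partial>law \<pi>) = (\<integral>\<^sup>+y. ennreal (dens \<pi> y) * h y \<partial>MY)"
  unfolding nn_integral_law_outcome[OF assms]
  by (rule nn_integral_cong_AE) (use AE_ennreal_outcome_density[OF \<pi>] in auto)

end

section \<open>Change of measure by the two weights\<close>

locale bandit_policies = bandit_model MX MA MY p q
  for MX :: "'x measure" and MA :: "'a measure" and MY :: "real measure"
    and p :: "'x \<Rightarrow> real" and q :: "'x \<Rightarrow> 'a \<Rightarrow> real \<Rightarrow> real" +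
  fixes \<pi>b \<pi>t :: "'a \<Rightarrow> 'x \<Rightarrow> real"
  assumes policy_b: "is_policy MX MA \<pi>b" and policy_t: "is_policy MX MA \<pi>t"
    and support: "\<And>x a. x \<in> space MX \<Longrightarrow> a \<in> space MA \<Longrightarrow> \<pi>t a x > 0 \<Longrightarrow> \<pi>b a x > 0"
begin

abbreviation "\<rho> \<equiv> policy_ratio \<pi>t \<pi>b"
abbreviation "w \<equiv> outcome_ratio MX MA p q \<pi>t \<pi>b"

sublocale Pb: prob_space "law \<pi>b" by (rule prob_space_law[OF policy_b])

lemmas [measurable] = measurable_policy[OF policy_b] measurable_policy[OF policy_t]
  measurable_joint_density[OF policy_b] measurable_joint_density[OF policy_t]
  measurable_outcome_density[OF policy_b] measurable_outcome_density[OF policy_t]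

lemma measurable_policy_ratio[measurable]:
  "(\<lambda>(x, a, y). \<rho> a x) \<in> borel_measurable (MX \<Otimes>\<^sub>M MA \<Otimes>\<^sub>M MY)"
proof -
  have "(\<lambda>z. (case (fst z, fst (snd z)) of (x, a) \<Rightarrow> \<pi>t a x) / (case (fst z, fst (snd z)) of (x, a) \<Rightarrow> \<pi>b a x))
      \<in> borel_measurable (MX \<Otimes>\<^sub>M MA \<Otimes>\<^sub>M MY)"
    by measurable
  then show ?thesis by (simp add: policy_ratio_def case_prod_beta')
qed

lemma measurable_outcome_ratio[measurable]: "w \<in> borel_measurable MY"
  unfolding outcome_ratio_def[abs_def] by measurable

lemma policy_ratio_nonneg: "x \<in> space MX \<Longrightarrow> a \<in> space MA \<Longrightarrow> 0 \<le> \<rho> a x"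
  using policy_b policy_t by (simp add: policy_ratio_def policy_nonneg)

lemma outcome_ratio_nonneg: "y \<in> space MY \<Longrightarrow> 0 \<le> w y"
  using policy_b policy_t by (simp add: outcome_ratio_def outcome_density_nonneg)

text \<open>The factors \<open>q\<close> and \<open>p\<close> are common to both joint densities, so
  \<open>\<rho>\<close> is a density of the target law relative to the behaviour law.\<close>

lemma nn_integral_policy_ratio:
  assumes [measurable]: "h \<in> borel_measurable (MX \<Otimes>\<^sub>M MA \<Otimes>\<^sub>M MY)"
  shows "(\<integral>\<^sup>+(x, a, y). ennreal (\<rho> a x) * h (x, a, y) \<partial>law \<pi>b) = (\<integral>\<^sup>+z. h z \<partial>law \<pi>t)"
proof -
  have [measurable]: "(\<lambda>(x, a, y). ennreal (\<rho> a x) * h (x, a, y)) \<in> borel_measurable (MX \<Otimes>\<^sub>M MA \<Otimes>\<^sub>M MY)"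
    using measurable_compose[OF measurable_policy_ratio measurable_ennreal] by (simp add: case_prod_beta')
  have "ennreal (jd \<pi>b (x, a, y)) * (ennreal (\<rho> a x) * h (x, a, y)) = ennreal (jd \<pi>t (x, a, y)) * h (x, a, y)"
    if "x \<in> space MX" "a \<in> space MA" "y \<in> space MY" for x a y
  proof -
    have "jd \<pi>b (x, a, y) * \<rho> a x = jd \<pi>t (x, a, y)"
      \<comment> \<open>Where \<open>\<pi>b a x = 0\<close> the quotient is 0 by convention; the
        support condition and nonnegativity force \<open>\<pi>t a x = 0\<close>, so both sides
        vanish.\<close>
      using support[OF that(1,2)] policy_nonneg[OF policy_t that(1,2)]
      by (cases "\<pi>b a x = 0") (auto simp: joint_density_def policy_ratio_def order_le_less)
    then have "ennreal (jd \<pi>b (x, a, y)) * ennreal (\<rho> a x) = ennreal (jd \<pi>t (x, a, y))"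
      using that policy_b by (simp add: ennreal_mult[symmetric] policy_ratio_nonneg joint_density_nonneg)
    then show ?thesis by (simp add: mult.assoc[symmetric])
  qed
  then show ?thesis
    by (simp add: nn_integral_law[OF policy_b] nn_integral_law[OF policy_t] cong: nn_integral_cong)
qed

text \<open>Absolute continuity passes to the marginals: the outcomes where
  \<open>dens \<pi>b\<close> vanishes form a null event of the behaviour law, hence of the target
  law, which is its reweighting by \<open>\<rho>\<close>. Arguing with the laws avoids comparing the
  two marginal integrals pointwise.\<close>

lemma AE_outcome_density_support: "AE y in MY. dens \<pi>b y = 0 \<longrightarrow> dens \<pi>t y = 0"
proof -
  let ?B = "{y\<in>space MY. dens \<pi>b y = 0}"
  have "(\<integral>\<^sup>+(x, a, y). indicator ?B y \<partial>law \<pi>b) = (\<integral>\<^sup>+y. ennreal (dens \<pi>b y) * indicator ?B y \<partial>MY)"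
    by (rule nn_integral_law_outcome_density[OF policy_b]) simp
  also have "\<dots> = 0"
    by (intro nn_integral_zero') (auto split: split_indicator)
  finally have "AE z in law \<pi>b. indicator ?B (snd (snd z)) = (0::ennreal)"
    by (subst (asm) nn_integral_0_iff_AE) (auto simp: joint_law_def case_prod_beta')
  then have "0 = (\<integral>\<^sup>+(x, a, y). ennreal (\<rho> a x) * indicator ?B (snd (snd (x, a, y))) \<partial>law \<pi>b)"
    by (intro nn_integral_zero'[symmetric]) (auto simp: case_prod_beta')
  also have "\<dots> = (\<integral>\<^sup>+(x, a, y). indicator ?B y \<partial>law \<pi>t)"
    by (subst nn_integral_policy_ratio) (auto simp: case_prod_beta')
  also have "\<dots> = (\<integral>\<^sup>+y. ennreal (dens \<pi>t y) * indicator ?B y \<partial>MY)"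
    by (rule nn_integral_law_outcome_density[OF policy_t]) simp
  finally have "AE y in MY. ennreal (dens \<pi>t y) * indicator ?B y = 0"
    by (subst (asm) eq_commute, subst (asm) nn_integral_0_iff_AE) auto
  with AE_space show ?thesis
    by eventually_elim
      (use outcome_density_nonneg[OF policy_t] in \<open>fastforce simp: ennreal_eq_0_iff indicator_def\<close>)
qed

text \<open>For functions of the outcome, the marginal densities can take the place of the joint
  ones. \<open>AE_outcome_density_support\<close> covers the outcomes where \<open>w\<close> has its
  default value 0.\<close>

lemma nn_integral_outcome_ratio:
  assumes [measurable]: "h \<in> borel_measurable MY"
  shows "(\<integral>\<^sup>+(x, a, y). ennreal (w y) * h y \<partial>law \<pi>b) = (\<integral>\<^sup>+(x, a, y). h y \<partial>law \<pi>t)"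
proof -
  have "(\<integral>\<^sup>+(x, a, y). ennreal (w y) * h y \<partial>law \<pi>b)
      = (\<integral>\<^sup>+y. ennreal (dens \<pi>b y) * (ennreal (w y) * h y) \<partial>MY)"
    by (rule nn_integral_law_outcome_density[OF policy_b]) simp
  also have "\<dots> = (\<integral>\<^sup>+y. ennreal (dens \<pi>t y) * h y \<partial>MY)"
  proof (rule nn_integral_cong_AE)
    show "AE y in MY. ennreal (dens \<pi>b y) * (ennreal (w y) * h y) = ennreal (dens \<pi>t y) * h y"
      using AE_outcome_density_support AE_space
    proof eventually_elim
      case (elim y)
      then have "dens \<pi>b y * w y = dens \<pi>t y"
        by (auto simp: outcome_ratio_def)
      then have "ennreal (dens \<pi>b y) * ennreal (w y) = ennreal (dens \<pi>t y)"
        using elim(2) policy_b by (simp add: ennreal_mult[symmetric] outcome_ratio_nonneg outcome_density_nonneg)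
      then show ?case by (simp add: mult.assoc[symmetric])
    qed
  qed
  also have "\<dots> = (\<integral>\<^sup>+(x, a, y). h y \<partial>law \<pi>t)"
    by (rule nn_integral_law_outcome_density[OF policy_t, symmetric]) simp
  finally show ?thesis .
qed

lemma sets_law: "sets (law \<pi>) = sets (MX \<Otimes>\<^sub>M MA \<Otimes>\<^sub>M MY)"
  and space_law: "space (law \<pi>) = space (MX \<Otimes>\<^sub>M MA \<Otimes>\<^sub>M MY)"
  by (simp_all add: joint_law_def)

text \<open>The mean of \<open>\<rho>\<close> is the total mass of the target law. A bound on the
  moments of \<open>\<rho> * y\<close> would not suffice here, as it gives no control near
  \<open>y = 0\<close>.\<close>

lemma integrable_policy_ratio: "integrable (law \<pi>b) (\<lambda>(x, a, y). \<rho> a x)"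
proof (rule integrableI_bounded)
  interpret Pt: prob_space "law \<pi>t" by (rule prob_space_law[OF policy_t])
  show "(\<lambda>(x, a, y). \<rho> a x) \<in> borel_measurable (law \<pi>b)"
    by (simp cong: measurable_cong_sets add: sets_law)
  have "(\<integral>\<^sup>+z. ennreal (norm (case z of (x, a, y) \<Rightarrow> \<rho> a x)) \<partial>law \<pi>b)
      = (\<integral>\<^sup>+(x, a, y). ennreal (\<rho> a x) * 1 \<partial>law \<pi>b)"
    by (intro nn_integral_cong) (auto simp: space_law space_pair_measure policy_ratio_nonneg)
  also have "\<dots> = 1"
    using nn_integral_policy_ratio[of "\<lambda>_. 1"] Pt.emeasure_space_1 by simp
  finally show "(\<integral>\<^sup>+z. ennreal (norm (case z of (x, a, y) \<Rightarrow> \<rho> a x)) \<partial>law \<pi>b) < \<infinity>"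
    by simp
qed

text \<open>On events determined by the outcome, both weights turn the behaviour law into the target
  law, so they have equal integrals there. Since \<open>w\<close> is itself a function of the
  outcome, this characterises it as the conditional expectation.\<close>

lemma outcome_ratio_eq_cond_exp:
  "AE z in law \<pi>b. real_cond_exp (law \<pi>b) (vimage_algebra (space (law \<pi>b)) (\<lambda>(x, a, y). y) borel)
     (\<lambda>(x, a, y). \<rho> a x) z = w (snd (snd z))"
proof -
  let ?Y = "\<lambda>(x, a, y). y"
  let ?F = "vimage_algebra (space (law \<pi>b)) ?Y borel"
  have Y: "?Y \<in> measurable (law \<pi>b) MY"
    by (simp add: measurable_cong_sets[OF sets_law])
  have Y_borel: "?Y \<in> borel_measurable (law \<pi>b)"
    using measurable_compose[OF Y outcome_measurable] by (simp add: case_prod_beta')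
  have sub: "subalgebra (law \<pi>b) ?F"
    unfolding subalgebra_def using measurable_sets[OF Y_borel] by (auto simp: sets_vimage_algebra2)
  interpret F: finite_measure_subalgebra "law \<pi>b" ?F
    by unfold_locales (rule sub)
  \<comment> \<open>Measurability of \<open>w\<close> is available relative to \<open>MY\<close>, so
    \<open>?Y\<close> must be measurable into \<open>MY\<close> and not just into the Borel sets;
    its values lie in \<open>space MY\<close>.\<close>
  have "?Y \<in> measurable ?F (restrict_space borel (space MY))"
    by (rule measurable_restrict_space2)
      (auto simp: space_law space_pair_measure intro: measurable_vimage_algebra1)
  then have YF: "?Y \<in> measurable ?F MY"
    by (simp add: measurable_cong_sets[OF refl sets_MY])
  have wF: "(\<lambda>z. w (snd (snd z))) \<in> borel_measurable ?F"
    using measurable_compose[OF YF measurable_outcome_ratio] by (simp add: case_prod_beta')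
  have \<rho>M: "(\<lambda>(x, a, y). \<rho> a x) \<in> borel_measurable (law \<pi>b)"
    using integrable_policy_ratio by auto
  have wM: "(\<lambda>z. w (snd (snd z))) \<in> borel_measurable (law \<pi>b)"
    using measurable_compose[OF Y measurable_outcome_ratio] by (simp add: case_prod_beta')
  have nn: "(\<integral>\<^sup>+z. ennreal (case z of (x, a, y) \<Rightarrow> \<rho> a x) * indicator A z \<partial>law \<pi>b)
      = (\<integral>\<^sup>+z. ennreal (w (snd (snd z))) * indicator A z \<partial>law \<pi>b)" if A: "A \<in> sets ?F" for A
  proof -
    \<comment> \<open>Writing the event as a preimage of a Borel set makes its indicator a function
      of the outcome, so both change-of-measure lemmas apply.\<close>
    obtain B where [measurable]: "B \<in> sets borel" and B: "A = ?Y -` B \<inter> space (law \<pi>b)"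
      using A by (auto simp: sets_vimage_algebra2)
    have ind: "indicator A z = (indicator B (snd (snd z)) :: ennreal)" if "z \<in> space (law \<pi>b)" for z
      using that by (auto simp: B indicator_def case_prod_beta')
    have [measurable]: "(indicator B :: real \<Rightarrow> ennreal) \<in> borel_measurable MY"
      using measurable_compose[OF outcome_measurable borel_measurable_indicator] by simp
    have "(\<integral>\<^sup>+z. ennreal (case z of (x, a, y) \<Rightarrow> \<rho> a x) * indicator A z \<partial>law \<pi>b)
        = (\<integral>\<^sup>+(x, a, y). ennreal (\<rho> a x) * indicator B (snd (snd (x, a, y))) \<partial>law \<pi>b)"
      by (intro nn_integral_cong) (simp add: ind case_prod_beta')
    also have "\<dots> = (\<integral>\<^sup>+z. indicator B (snd (snd z)) \<partial>law \<pi>t)"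
      by (rule nn_integral_policy_ratio) simp
    also have "\<dots> = (\<integral>\<^sup>+(x, a, y). ennreal (w y) * indicator B y \<partial>law \<pi>b)"
      by (subst nn_integral_outcome_ratio) (auto simp: case_prod_beta')
    also have "\<dots> = (\<integral>\<^sup>+z. ennreal (w (snd (snd z))) * indicator A z \<partial>law \<pi>b)"
      by (intro nn_integral_cong) (simp add: ind case_prod_beta')
    finally show ?thesis .
  qed
  have \<rho>_nonneg: "0 \<le> (case z of (x, a, y) \<Rightarrow> \<rho> a x)" if "z \<in> space (law \<pi>b)" for z
    using that by (auto simp: space_law space_pair_measure policy_ratio_nonneg)
  have w_nonneg: "0 \<le> w (snd (snd z))" if "z \<in> space (law \<pi>b)" for z
    using that by (auto simp: space_law space_pair_measure outcome_ratio_nonneg)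
  show ?thesis
  proof (rule F.real_cond_exp_charact[OF _ integrable_policy_ratio _ wF])
    \<comment> \<open>Taking the whole space as the event in \<open>nn\<close> transfers the finite
      mean from \<open>\<rho>\<close> to \<open>w\<close>.\<close>
    have "(\<integral>\<^sup>+z. ennreal (norm (w (snd (snd z)))) \<partial>law \<pi>b)
        = (\<integral>\<^sup>+z. ennreal (w (snd (snd z))) * indicator (space (law \<pi>b)) z \<partial>law \<pi>b)"
      by (intro nn_integral_cong) (simp add: w_nonneg)
    also have "\<dots> = (\<integral>\<^sup>+z. ennreal (norm (case z of (x, a, y) \<Rightarrow> \<rho> a x)) \<partial>law \<pi>b)"
      using sets.top[of ?F] \<rho>_nonneg by (subst nn[symmetric]) (force intro!: nn_integral_cong)+
    also have "\<dots> < \<infinity>"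
      using integrable_policy_ratio by (simp add: integrable_iff_bounded)
    finally show "integrable (law \<pi>b) (\<lambda>z. w (snd (snd z)))"
      using wM by (simp add: integrable_iff_bounded)
  next
    fix A assume A: "A \<in> sets ?F"
    then have AM: "A \<in> sets (law \<pi>b)" using sub by (auto simp: subalgebra_def)
    \<comment> \<open>Both weights are nonnegative, so their Bochner integrals over \<open>A\<close>
      are determined by the nonnegative integrals compared in \<open>nn\<close>.\<close>
    have set_int: "(LINT z:A|law \<pi>b. f z) = enn2real (\<integral>\<^sup>+z. ennreal (f z) * indicator A z \<partial>law \<pi>b)"
      if "f \<in> borel_measurable (law \<pi>b)" "\<And>z. z \<in> space (law \<pi>b) \<Longrightarrow> 0 \<le> f z" for f :: "'x \<times> 'a \<times> real \<Rightarrow> real"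
      unfolding set_lebesgue_integral_def using that AM
      by (subst integral_eq_nn_integral)
        (auto intro!: arg_cong[of _ _ enn2real] nn_integral_cong split: split_indicator)
    show "(LINT z:A|law \<pi>b. (case z of (x, a, y) \<Rightarrow> \<rho> a x)) = (LINT z:A|law \<pi>b. w (snd (snd z)))"
      by (simp only: set_int[OF \<rho>M \<rho>_nonneg] set_int[OF wM w_nonneg] nn[OF A])
  qed
qed

end

section \<open>Comparison of the two estimators\<close>

theorem proposition3p3:
  fixes MX :: "'x measure" and MA :: "'a measure" and MY :: "real measure"
    and \<Y> :: "real set"
    and p :: "'x \<Rightarrow> real" and q :: "'x \<Rightarrow> 'a \<Rightarrow> real \<Rightarrow> real"
    and \<pi>b \<pi>t :: "'a \<Rightarrow> 'x \<Rightarrow> real"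
    and \<rho> :: "'a \<Rightarrow> 'x \<Rightarrow> real" and w :: "real \<Rightarrow> real"
    and Pb :: "('x \<times> 'a \<times> real) measure"
    and \<Omega> :: "'w measure" and D :: "nat \<Rightarrow> 'w \<Rightarrow> 'x \<times> 'a \<times> real" and n :: nat
  assumes "sigma_finite_measure MX" and "sigma_finite_measure MA" and "sigma_finite_measure MY"
    and "sets MY = sets (restrict_space borel \<Y>)"
    and "is_density MX p"
    and "is_cond_density (MX \<Otimes>\<^sub>M MA) MY (\<lambda>(x, a). q x a)"
    and "is_policy MX MA \<pi>b" and "is_policy MX MA \<pi>t"
    and support: "\<forall>x\<in>space MX. \<forall>a\<in>space MA. \<pi>t a x > 0 \<longrightarrow> \<pi>b a x > 0"
    and rho: "\<rho> = policy_ratio \<pi>t \<pi>b"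
    and w: "w = outcome_ratio MX MA p q \<pi>t \<pi>b"
    and Pb: "Pb = joint_law MX MA MY p q \<pi>b"
    and "n \<ge> 1"
    and "prob_space \<Omega>"
    and indep: "prob_space.indep_vars \<Omega> (\<lambda>_. MX \<Otimes>\<^sub>M MA \<Otimes>\<^sub>M MY) D {..<n}"
    and ident: "\<forall>i<n. distr \<Omega> (MX \<Otimes>\<^sub>M MA \<Otimes>\<^sub>M MY) (D i) = Pb"
    and finite_variance: "integrable Pb (\<lambda>(x, a, y). (\<rho> a x * y)\<^sup>2)"
  shows "prob_space.variance \<Omega> (\<lambda>\<omega>. MR_estimator w n (\<lambda>i. D i \<omega>))
           \<le> prob_space.variance \<Omega> (\<lambda>\<omega>. IPW_estimator \<rho> n (\<lambda>i. D i \<omega>)) \<and>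
         prob_space.variance \<Omega> (\<lambda>\<omega>. IPW_estimator \<rho> n (\<lambda>i. D i \<omega>))
             - prob_space.variance \<Omega> (\<lambda>\<omega>. MR_estimator w n (\<lambda>i. D i \<omega>))
           = 1 / real n *
               prob_space.expectation Pb
                 (\<lambda>z. cond_variance Pb (\<lambda>(x, a, y). \<rho> a x) (\<lambda>(x, a, y). y) z * (snd (snd z))\<^sup>2) \<and>
         0 \<le> 1 / real n *
               prob_space.expectation Pb
                 (\<lambda>z. cond_variance Pb (\<lambda>(x, a, y). \<rho> a x) (\<lambda>(x, a, y). y) z * (snd (snd z))\<^sup>2)"
proof -
  \<comment> \<open>Equal sigma-algebras have equal underlying spaces, which turns the assumption
    about \<open>\<Y>\<close> into the form of \<open>sets_MY\<close>.\<close>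
  have [simp]: "space MY = \<Y>"
    using sets_eq_imp_space_eq[OF assms(4)] by (simp add: space_restrict_space)
  interpret bandit_policies MX MA MY p q \<pi>b \<pi>t
    by unfold_locales (use assms in \<open>auto simp: sigma_finite_measure_def\<close>)
  interpret \<Omega>: prob_space \<Omega> by fact
  define Y :: "'x \<times> 'a \<times> real \<Rightarrow> real" where "Y = (\<lambda>(x, a, y). y)"
  define X where "X = (\<lambda>(x, a, y::real). \<rho> a x)"
  define C where "C = real_cond_exp Pb (vimage_algebra (space Pb) Y borel) X"
  define W where "W z = w (snd (snd z)) * Y z" for z :: "'x \<times> 'a \<times> real"
  have Pb_sets: "sets Pb = sets (MX \<Otimes>\<^sub>M MA \<Otimes>\<^sub>M MY)"
    unfolding Pb by (rule sets_law)
  interpret P: prob_space Pb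
    unfolding Pb by (rule Pb.prob_space_axioms)
  have X_int: "integrable Pb X"
    using integrable_policy_ratio by (simp add: X_def Pb rho)
  have "Y \<in> borel_measurable (MX \<Otimes>\<^sub>M MA \<Otimes>\<^sub>M MY)" "X \<in> borel_measurable (MX \<Otimes>\<^sub>M MA \<Otimes>\<^sub>M MY)"
    "(\<lambda>z. w (snd (snd z))) \<in> borel_measurable (MX \<Otimes>\<^sub>M MA \<Otimes>\<^sub>M MY)"
    unfolding Y_def X_def rho w by measurable
  note meas_prod[measurable] = this
  \<comment> \<open>The observations take values in the product space, whereas expectations are
    taken under \<open>Pb\<close>; the two have the same measurable sets.\<close>
  note meas[measurable] = meas_prod[folded measurable_cong_sets[OF Pb_sets refl]]
  have W_prod: "W \<in> borel_measurable (MX \<Otimes>\<^sub>M MA \<Otimes>\<^sub>M MY)" "W \<in> borel_measurable Pb"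
    unfolding W_def[abs_def] by measurable
  have C_meas[measurable]: "C \<in> borel_measurable Pb"
    by (simp add: C_def)
  have sq: "integrable Pb (\<lambda>z. (X z * Y z)\<^sup>2)"
    using finite_variance by (simp add: X_def Y_def case_prod_beta')
  have C_W: "AE z in Pb. C z * Y z = W z"
    using outcome_ratio_eq_cond_exp unfolding C_def X_def Y_def W_def Pb rho w by eventually_elim simp
  note ce = P.cond_exp_generated[OF X_int meas(1) sq, folded C_def]
  \<comment> \<open>The projection facts \<open>ce\<close> concern \<open>C * Y\<close>; almost sure
    equality carries its first two moments over to \<open>W\<close>, the summand of the MR
    estimator.\<close>
  have CW_sq: "AE z in Pb. (C z * Y z)\<^sup>2 = (W z)\<^sup>2"
    using C_W by eventually_elim simp
  have W_sq: "integrable Pb (\<lambda>z. (W z)\<^sup>2)"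
    using ce(1) integrable_cong_AE[OF _ _ CW_sq] W_prod(2) by simp
  have W_mean: "P.expectation W = P.expectation (\<lambda>z. X z * Y z)"
    using integral_cong_AE[OF _ _ C_W] W_prod(2) ce(2) by simp
  have W_sq_mean: "P.expectation (\<lambda>z. (W z)\<^sup>2) = P.expectation (\<lambda>z. (C z * Y z)\<^sup>2)"
    using integral_cong_AE[OF _ _ CW_sq] W_prod(2) by simp
  have IPW: "IPW_estimator \<rho> n d = 1 / real n * (\<Sum>i<n. X (d i) * Y (d i))"
    and MR: "MR_estimator w n d = 1 / real n * (\<Sum>i<n. W (d i))" for d
    by (simp_all add: IPW_estimator_def MR_estimator_def X_def Y_def W_def case_prod_beta')
  have variance_estimator: "\<Omega>.variance (\<lambda>\<omega>. 1 / real n * (\<Sum>i<n. f (D i \<omega>)))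
      = 1 / real n * (P.expectation (\<lambda>z. (f z)\<^sup>2) - (P.expectation f)\<^sup>2)"
    if f: "f \<in> borel_measurable (MX \<Otimes>\<^sub>M MA \<Otimes>\<^sub>M MY)" "integrable Pb (\<lambda>z. (f z)\<^sup>2)" for f
  proof -
    have "integrable Pb f"
      using f by (intro P.square_integrable_imp_integrable[OF _ f(2)]) (simp add: measurable_cong_sets[OF Pb_sets])
    from P.variance_eq[OF this f(2)] \<Omega>.variance_iid_mean[OF \<open>n \<ge> 1\<close> indep _ f] ident
    show ?thesis by simp
  qed
  define V where "V = P.expectation (\<lambda>z. cond_variance Pb X Y z * (Y z)\<^sup>2)"
  \<comment> \<open>By \<open>W_mean\<close> the squared means cancel, leaving \<open>1 / n\<close>
    times the difference of second moments, which \<open>ce(3)\<close> evaluates as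
    \<open>V\<close>.\<close>
  have "\<Omega>.variance (\<lambda>\<omega>. IPW_estimator \<rho> n (\<lambda>i. D i \<omega>)) - \<Omega>.variance (\<lambda>\<omega>. MR_estimator w n (\<lambda>i. D i \<omega>))
      = 1 / real n * V"
    unfolding IPW MR variance_estimator[OF W_prod(1) W_sq]
    using variance_estimator[of "\<lambda>z. X z * Y z"] sq ce(3)
    by (simp add: V_def W_mean W_sq_mean diff_divide_distrib)
  moreover have "0 \<le> 1 / real n * V"
    using ce(4) by (simp add: V_def)
  moreover have "V = P.expectation (\<lambda>z. cond_variance Pb (\<lambda>(x, a, y). \<rho> a x) (\<lambda>(x, a, y). y) z * (snd (snd z))\<^sup>2)"
    by (simp add: V_def X_def Y_def case_prod_beta')
  ultimately show ?thesis by simp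
qed

end
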